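(* Let $L$ be a logic above $\mathbf{S4}$. The following are equivalent. (1) $L$ is well-connected. (2) There is a general space over $\mathbf{L}_2$ whose logic is $L$. (3) $L=L(\mathfrak{A})$ for some subalgebra $\mathfrak{A}$ of the closure algebra $\mathbf{L}_2^+$.
   Context: Modal formulas are built from a countably infinite set of propositional letters using the Boolean connectives, $\top,\bot$, and the unary operators $\Diamond,\Box$. A normal modal logic is a set of modal formulas containing all tautologies, all instances of $\Diamond(\varphi\vee\psi)\leftrightarrow(\Diamond\varphi\vee\Diamond\psi)$ and $\Box\varphi\leftrightarrow\neg\Diamond\neg\varphi$, and $\Diamond\bot\leftrightarrow\bot$, and closed under Modus Ponens, Necessitation ($\varphi/\Box\varphi$) and uniform substitution. $\mathbf{S4}$ is the least normal modal logic containing all instances of $\Diamond\Diamond\varphi\to\Diamond\varphi$ and $\varphi\to\Diamond\varphi$. A logic above $\mathbf{S4}$ is a normal modal logic containing $\mathbf{S4}$. A modal algebra is a Boolean algebra $A$ with a unary $\Diamond$ satisfying $\Diamond(a\vee b)=\Diamond a\vee\Diamond b$ and $\Diamond 0=0$; $\Box a=\neg\Diamond\neg a$. It is a closure algebra if $a\le\Diamond a$ and $\Diamond\Diamond a\le\Diamond a$ for all $a$. A formula is valid in a modal algebra if, read as a polynomial, it evaluates to $1$ under every assignment; $L(\mathfrak{A})$ is the set of formulas valid in $\mathfrak{A}$. A closure algebra is well-connected if $\Diamond a\wedge\Diamond b=0$ implies $a=0$ or $b=0$. A logic $L$ above $\mathbf{S4}$ is well-connected if $L=L(\mathfrak{A})$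 for some well-connected closure algebra $\mathfrak{A}$. For a topological space $X$ with closure operator $\mathbf{c}$, $X^+=(\wp(X),\mathbf{c})$ is its closure algebra. A general space over $X$ is a pair $(X,\mathcal{P})$ with $\mathcal{P}$ a subalgebra of $X^+$; its logic is $L(\mathcal{P})$. $T_2$ is the set of finite $\{0,1\}$-valued sequences (including the empty one), and $L_2$ is $T_2$ together with all infinite sequences $\omega\to\{0,1\}$, ordered by $a\le b$ iff $a$ is an initial segment of $b$. This order is a directed complete partial order; $\mathbf{L}_2$ denotes $L_2$ with the Scott topology, for which $\{\uparrow a: a\in T_2\}$ is a basis, where $\uparrow a=\{b\in L_2: a\le b\}$.
   Formalization: Boolean algebras are taken to be nontrivial (0 ≠ 1); otherwise the one-element algebra makes the inconsistent logic well-connected, although no subalgebra of the closure algebra of L_2 has that logic. *)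

theory Defs
  imports
    "HOL-Analysis.Abstract_Topology"
    "HOL-Library.Sublist"
    "HOL-Library.Lub_Glb"
begin

section \<open>Modal formulas and logics above S4\<close>

datatype fm =
    Letter nat
  | FTrue
  | FFalse
  | Neg fm
  | Conj fm fm
  | Disj fm fm
  | Imp fm fm
  | Dia fm
  | Box fm

definition Iff :: "fm \<Rightarrow> fm \<Rightarrow> fm" where
  "Iff p q = Conj (Imp p q) (Imp q p)"

primrec subst :: "(nat \<Rightarrow> fm) \<Rightarrow> fm \<Rightarrow> fm" where
  "subst s (Letter n) = s n"
| "subst s FTrue = FTrue"
| "subst s FFalse = FFalse"
| "subst s (Neg p) = Neg (subst s p)"
| "subst s (Conj p q) = Conj (subst s p) (subst s q)"
| "subst s (Disj p q) = Disj (subst s p) (subst s q)"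
| "subst s (Imp p q) = Imp (subst s p) (subst s q)"
| "subst s (Dia p) = Dia (subst s p)"
| "subst s (Box p) = Box (subst s p)"

text \<open>Propositional truth: letters and formulas starting with a modal operator are treated as
  atoms, whose truth values are given by \<open>v\<close>.\<close>

primrec bool_eval :: "(fm \<Rightarrow> bool) \<Rightarrow> fm \<Rightarrow> bool" where
  "bool_eval v (Letter n) = v (Letter n)"
| "bool_eval v FTrue = True"
| "bool_eval v FFalse = False"
| "bool_eval v (Neg p) = (\<not> bool_eval v p)"
| "bool_eval v (Conj p q) = (bool_eval v p \<and> bool_eval v q)"
| "bool_eval v (Disj p q) = (bool_eval v p \<or> bool_eval v q)"
| "bool_eval v (Imp p q) = (bool_eval v p \<longrightarrow> bool_eval v q)"
| "bool_eval v (Dia p) = v (Dia p)"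
| "bool_eval v (Box p) = v (Box p)"

definition tautology :: "fm \<Rightarrow> bool" where
  "tautology p \<longleftrightarrow> (\<forall>v. bool_eval v p)"

definition normal_modal_logic :: "fm set \<Rightarrow> bool" where
  "normal_modal_logic L \<longleftrightarrow>
     (\<forall>p. tautology p \<longrightarrow> p \<in> L) \<and>
     (\<forall>p q. Iff (Dia (Disj p q)) (Disj (Dia p) (Dia q)) \<in> L) \<and>
     (\<forall>p. Iff (Box p) (Neg (Dia (Neg p))) \<in> L) \<and>
     Iff (Dia FFalse) FFalse \<in> L \<and>
     (\<forall>p q. p \<in> L \<longrightarrow> Imp p q \<in> L \<longrightarrow> q \<in> L) \<and>
     (\<forall>p. p \<in> L \<longrightarrow> Box p \<in> L) \<and>
     (\<forall>p s. p \<in> L \<longrightarrow> subst s p \<in> L)"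

definition S4 :: "fm set" where
  "S4 = \<Inter> {L. normal_modal_logic L \<and>
              (\<forall>p. Imp (Dia (Dia p)) (Dia p) \<in> L) \<and>
              (\<forall>p. Imp p (Dia p) \<in> L)}"

definition logic_above_S4 :: "fm set \<Rightarrow> bool" where
  "logic_above_S4 L \<longleftrightarrow> normal_modal_logic L \<and> S4 \<subseteq> L"


section \<open>Modal algebras\<close>

record 'a modal_alg =
  carrier :: "'a set"
  meet :: "'a \<Rightarrow> 'a \<Rightarrow> 'a"
  join :: "'a \<Rightarrow> 'a \<Rightarrow> 'a"
  cmpl :: "'a \<Rightarrow> 'a"
  bot_el :: 'a
  top_el :: 'a
  dia :: "'a \<Rightarrow> 'a"

text \<open>The Boolean laws are those of \<^locale>\<open>abstract_boolean_algebra\<close>, relativised to a carrier.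
  Boolean algebras are understood to be nontrivial, that is, \<open>0 \<noteq> 1\<close>. Without this convention the
  one-element algebra would be a well-connected closure algebra and would make the set of all
  formulas a well-connected logic.\<close>

locale modal_algebra =
  fixes A :: "'a modal_alg"
  assumes meet_closed: "\<lbrakk>x \<in> carrier A; y \<in> carrier A\<rbrakk> \<Longrightarrow> meet A x y \<in> carrier A"
    and join_closed: "\<lbrakk>x \<in> carrier A; y \<in> carrier A\<rbrakk> \<Longrightarrow> join A x y \<in> carrier A"
    and cmpl_closed: "x \<in> carrier A \<Longrightarrow> cmpl A x \<in> carrier A"
    and bot_closed: "bot_el A \<in> carrier A"
    and top_closed: "top_el A \<in> carrier A"
    and dia_closed: "x \<in> carrier A \<Longrightarrow> dia A x \<in> carrier A"
    and meet_assoc: "\<lbrakk>x \<in> carrier A; y \<in> carrier A; z \<in> carrier A\<rbrakk> \<Longrightarrow>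
      meet A (meet A x y) z = meet A x (meet A y z)"
    and meet_commute: "\<lbrakk>x \<in> carrier A; y \<in> carrier A\<rbrakk> \<Longrightarrow> meet A x y = meet A y x"
    and join_assoc: "\<lbrakk>x \<in> carrier A; y \<in> carrier A; z \<in> carrier A\<rbrakk> \<Longrightarrow>
      join A (join A x y) z = join A x (join A y z)"
    and join_commute: "\<lbrakk>x \<in> carrier A; y \<in> carrier A\<rbrakk> \<Longrightarrow> join A x y = join A y x"
    and meet_join_distrib: "\<lbrakk>x \<in> carrier A; y \<in> carrier A; z \<in> carrier A\<rbrakk> \<Longrightarrow>
      meet A x (join A y z) = join A (meet A x y) (meet A x z)"
    and join_meet_distrib: "\<lbrakk>x \<in> carrier A; y \<in> carrier A; z \<in> carrier A\<rbrakk> \<Longrightarrow>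
      join A x (meet A y z) = meet A (join A x y) (join A x z)"
    and meet_top: "x \<in> carrier A \<Longrightarrow> meet A x (top_el A) = x"
    and join_bot: "x \<in> carrier A \<Longrightarrow> join A x (bot_el A) = x"
    and meet_cmpl: "x \<in> carrier A \<Longrightarrow> meet A x (cmpl A x) = bot_el A"
    and join_cmpl: "x \<in> carrier A \<Longrightarrow> join A x (cmpl A x) = top_el A"
    and nontrivial: "bot_el A \<noteq> top_el A"
    and dia_join: "\<lbrakk>x \<in> carrier A; y \<in> carrier A\<rbrakk> \<Longrightarrow>
      dia A (join A x y) = join A (dia A x) (dia A y)"
    and dia_bot: "dia A (bot_el A) = bot_el A"

definition alg_le :: "'a modal_alg \<Rightarrow> 'a \<Rightarrow> 'a \<Rightarrow> bool" where
  "alg_le A x y \<longleftrightarrow> meet A x y = x"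

locale closure_algebra = modal_algebra +
  assumes dia_increasing: "x \<in> carrier A \<Longrightarrow> alg_le A x (dia A x)"
    and dia_dia: "x \<in> carrier A \<Longrightarrow> alg_le A (dia A (dia A x)) (dia A x)"

definition well_connected :: "'a modal_alg \<Rightarrow> bool" where
  "well_connected A \<longleftrightarrow>
     (\<forall>a\<in>carrier A. \<forall>b\<in>carrier A.
        meet A (dia A a) (dia A b) = bot_el A \<longrightarrow> a = bot_el A \<or> b = bot_el A)"

primrec alg_eval :: "'a modal_alg \<Rightarrow> (nat \<Rightarrow> 'a) \<Rightarrow> fm \<Rightarrow> 'a" where
  "alg_eval A v (Letter n) = v n"
| "alg_eval A v FTrue = top_el A"
| "alg_eval A v FFalse = bot_el A"
| "alg_eval A v (Neg p) = cmpl A (alg_eval A v p)"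
| "alg_eval A v (Conj p q) = meet A (alg_eval A v p) (alg_eval A v q)"
| "alg_eval A v (Disj p q) = join A (alg_eval A v p) (alg_eval A v q)"
| "alg_eval A v (Imp p q) = join A (cmpl A (alg_eval A v p)) (alg_eval A v q)"
| "alg_eval A v (Dia p) = dia A (alg_eval A v p)"
| "alg_eval A v (Box p) = cmpl A (dia A (cmpl A (alg_eval A v p)))"

definition alg_valid :: "'a modal_alg \<Rightarrow> fm \<Rightarrow> bool" where
  "alg_valid A p \<longleftrightarrow> (\<forall>v. (\<forall>n. v n \<in> carrier A) \<longrightarrow> alg_eval A v p = top_el A)"

definition alg_logic :: "'a modal_alg \<Rightarrow> fm set" where
  "alg_logic A = {p. alg_valid A p}"

text \<open>The first argument fixes the type that provides the carriers. The underlying notion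
  quantifies over algebras of arbitrary size, so theorems about this predicate should be stated for
  an arbitrary infinite type \<open>'a\<close>: every algebra, finite or not, has an isomorphic copy whose
  carrier is a subset of some infinite type.\<close>

definition well_connected_logic :: "'a itself \<Rightarrow> fm set \<Rightarrow> bool" where
  "well_connected_logic T L \<longleftrightarrow>
     (\<exists>A :: 'a modal_alg. closure_algebra A \<and> well_connected A \<and> L = alg_logic A)"

definition subalgebra :: "'a modal_alg \<Rightarrow> 'a modal_alg \<Rightarrow> bool" where
  "subalgebra B A \<longleftrightarrow>
     carrier B \<subseteq> carrier A \<and>
     bot_el B = bot_el A \<and> bot_el A \<in> carrier B \<and>
     top_el B = top_el A \<and> top_el A \<in> carrier B \<and>
     (\<forall>x\<in>carrier B. \<forall>y\<in>carrier B. meet B x y = meet A x y \<and> meet A x y \<in> carrier B) \<and>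
     (\<forall>x\<in>carrier B. \<forall>y\<in>carrier B. join B x y = join A x y \<and> join A x y \<in> carrier B) \<and>
     (\<forall>x\<in>carrier B. cmpl B x = cmpl A x \<and> cmpl A x \<in> carrier B) \<and>
     (\<forall>x\<in>carrier B. dia B x = dia A x \<and> dia A x \<in> carrier B)"


section \<open>Topological spaces and general spaces\<close>

definition space_alg :: "'a topology \<Rightarrow> 'a set modal_alg" where
  "space_alg X =
     \<lparr> carrier = Pow (topspace X),
       meet = (\<inter>),
       join = (\<union>),
       cmpl = (\<lambda>S. topspace X - S),
       bot_el = {},
       top_el = topspace X,
       dia = (\<lambda>S. X closure_of S) \<rparr>"

definition subset_alg :: "'a topology \<Rightarrow> 'a set set \<Rightarrow> 'a set modal_alg" where
  "subset_alg X P = (space_alg X)\<lparr>carrier := P\<rparr>"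

text \<open>The pair \<open>(X, P)\<close> is a general space.\<close>

definition general_space :: "'a topology \<Rightarrow> 'a set set \<Rightarrow> bool" where
  "general_space X P \<longleftrightarrow> subalgebra (subset_alg X P) (space_alg X)"

definition general_space_logic :: "'a topology \<Rightarrow> 'a set set \<Rightarrow> fm set" where
  "general_space_logic X P = alg_logic (subset_alg X P)"


section \<open>The Scott topology\<close>

definition directed :: "'a::order set \<Rightarrow> bool" where
  "directed D \<longleftrightarrow> D \<noteq> {} \<and> (\<forall>x\<in>D. \<forall>y\<in>D. \<exists>z\<in>D. x \<le> z \<and> y \<le> z)"

definition scott_open :: "'a::order set \<Rightarrow> bool" where
  "scott_open U \<longleftrightarrow>
     (\<forall>x y. x \<in> U \<longrightarrow> x \<le> y \<longrightarrow> y \<in> U) \<and>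
     (\<forall>D s. directed D \<longrightarrow> isLub UNIV D s \<longrightarrow> s \<in> U \<longrightarrow> D \<inter> U \<noteq> {})"

definition scott_topology :: "'a::order topology" where
  "scott_topology = topology scott_open"

lemma istopology_scott_open: "istopology (scott_open :: 'a::order set \<Rightarrow> bool)"
  unfolding istopology_def
proof (intro conjI allI impI)
  fix S T :: "'a set"
  assume S: "scott_open S" and T: "scott_open T"
  have "D \<inter> (S \<inter> T) \<noteq> {}" if D: "directed D" "isLub UNIV D s" "s \<in> S \<inter> T" for D s
  proof -
    obtain x y where "x \<in> D" "x \<in> S" "y \<in> D" "y \<in> T"
      using S T D unfolding scott_open_def by blast
    moreover from this obtain z where "z \<in> D" "x \<le> z" "y \<le> z"
      using D(1) unfolding directed_def by blast
    ultimately show ?thesis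
      using S T unfolding scott_open_def by blast
  qed
  then show "scott_open (S \<inter> T)"
    using S T unfolding scott_open_def by blast
next
  fix K :: "'a set set"
  assume "\<forall>U\<in>K. scott_open U"
  then show "scott_open (\<Union> K)"
    unfolding scott_open_def by blast
qed

lemma openin_scott_topology: "openin scott_topology U \<longleftrightarrow> scott_open U"
  by (simp add: scott_topology_def istopology_scott_open topology_inverse')


section \<open>The infinite binary tree with limits\<close>

text \<open>Finite and infinite \<open>{0,1}\<close>-valued sequences; \<^const>\<open>False\<close> stands for \<open>0\<close> and
  \<^const>\<open>True\<close> for \<open>1\<close>.\<close>

datatype binseq = FinSeq "bool list" | InfSeq "nat \<Rightarrow> bool"

instantiation binseq :: order
begin

fun less_eq_binseq :: "binseq \<Rightarrow> binseq \<Rightarrow> bool" where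
  "FinSeq xs \<le> FinSeq ys \<longleftrightarrow> prefix xs ys"
| "FinSeq xs \<le> InfSeq f \<longleftrightarrow> (\<forall>i < length xs. xs ! i = f i)"
| "InfSeq f \<le> FinSeq ys \<longleftrightarrow> False"
| "InfSeq f \<le> InfSeq g \<longleftrightarrow> f = g"

definition less_binseq :: "binseq \<Rightarrow> binseq \<Rightarrow> bool" where
  "less_binseq a b \<longleftrightarrow> a \<le> b \<and> \<not> b \<le> a"

instance
proof
  fix a b c :: binseq
  show "a < b \<longleftrightarrow> a \<le> b \<and> \<not> b \<le> a"
    by (fact less_binseq_def)
  show "a \<le> a"
    by (cases a) auto
  show "a \<le> c" if "a \<le> b" "b \<le> c"
    using that by (cases a; cases b; cases c)
      (auto simp: prefix_def nth_append dest: trans_less_add1 split: if_splits)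
  show "a = b" if "a \<le> b" "b \<le> a"
    using that by (cases a; cases b) auto
qed

end

definition T2 :: "binseq set" where
  "T2 = range FinSeq"

text \<open>The set \<open>L\<^sub>2\<close> is the whole type \<^typ>\<open>binseq\<close>.\<close>

definition L2_space :: "binseq topology" where
  "L2_space = scott_topology"

lemma topspace_L2_space: "topspace L2_space = UNIV"
proof -
  have "scott_open (UNIV :: binseq set)"
    by (auto simp: scott_open_def directed_def)
  then show ?thesis
    unfolding L2_space_def topspace_def openin_scott_topology by blast
qed


lemma prefix_map_upt: "m \<le> n \<Longrightarrow> prefix (map f [0..<m]) (map f [0..<n])"
  using upt_add_eq_append[of 0 m "n - m"] by simp

lemma binseq_comparable:
  fixes a b c :: binseq
  assumes "a \<le> c" "b \<le> c"
  shows "a \<le> b \<or> b \<le> a"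
proof -
  have "prefix xs ys \<or> prefix ys xs"
    if "\<forall>i < length xs. xs ! i = f i" "\<forall>i < length ys. ys ! i = f i" for xs ys :: "bool list" and f
  proof -
    have eq: "xs = map f [0..<length xs]" "ys = map f [0..<length ys]"
      using that by (auto intro: nth_equalityI)
    show ?thesis
    proof (cases "length xs \<le> length ys")
      case True
      then show ?thesis
        by (subst (1 2) eq(1), subst (1 2) eq(2)) (simp add: prefix_map_upt)
    next
      case False
      then show ?thesis
        by (subst (1 2) eq(1), subst (1 2) eq(2)) (simp add: prefix_map_upt)
    qed
  qed
  then show ?thesis
    using assms by (cases a; cases b; cases c) (auto dest: prefix_same_cases)
qed

lemma scott_open_atLeast_FinSeq: "scott_open {FinSeq xs..}"
proof -
  have "\<exists>d\<in>D. FinSeq xs \<le> d"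
    if D: "directed D" and lub: "isLub UNIV D s" and s: "FinSeq xs \<le> s" for D s
  proof (rule ccontr)
    assume none: "\<not> (\<exists>d\<in>D. FinSeq xs \<le> d)"
    have ub: "d \<le> s" if "d \<in> D" for d
      using lub that by (meson isLubD2)
    have least: "s \<le> u" if "\<forall>d\<in>D. d \<le> u" for u
      using lub that by (meson UNIV_I isLub_le_isUb isUbI setleI)
    have below: "\<exists>ys. d = FinSeq ys \<and> strict_prefix ys xs" if "d \<in> D" for d
    proof -
      have "d \<le> FinSeq xs"
        using binseq_comparable[OF ub[OF that] s] none that by blast
      then show ?thesis
        using none that by (cases d) (auto simp: strict_prefix_def)
    qed
    obtain d where "d \<in> D"
      using D by (auto simp: directed_def)
    then have "xs \<noteq> []"
      using below by fastforce
    then obtain zs z where xs: "xs = zs @ [z]"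
      by (metis append_butlast_last_id)
    have "\<forall>d\<in>D. d \<le> FinSeq zs"
      using below xs by (force simp: strict_prefix_def)
    then have "FinSeq xs \<le> FinSeq zs"
      using least s order_trans by blast
    then show False
      using xs by (auto dest: prefix_length_le)
  qed
  then show ?thesis
    unfolding scott_open_def by fastforce
qed

lemma InfSeq_isLub: "isLub UNIV (range (\<lambda>n. FinSeq (map f [0..<n]))) (InfSeq f)"
proof -
  have "InfSeq f \<le> u" if u: "\<forall>n. FinSeq (map f [0..<n]) \<le> u" for u
  proof (cases u)
    case (FinSeq ys)
    then have "prefix (map f [0..<Suc (length ys)]) ys"
      using u less_eq_binseq.simps(1) by blast
    then show ?thesis
      by (auto dest: prefix_length_le)
  next
    case (InfSeq g)
    have "f n = g n" for n
      using u[rule_format, of "Suc n"] InfSeq by (auto simp del: upt_Suc)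
    then show ?thesis
      using InfSeq by auto
  qed
  then show ?thesis
    by (auto simp: isLub_def leastP_def isUb_def setle_def setge_def)
qed

lemma openin_L2_space_basis:
  "openin L2_space U \<longleftrightarrow> (\<exists>S\<subseteq>T2. U = (\<Union>a\<in>S. {a..}))"
proof
  assume "openin L2_space U"
  then have U: "scott_open U"
    by (simp add: L2_space_def openin_scott_topology)
  have "\<exists>a\<in>T2 \<inter> U. a \<le> x" if "x \<in> U" for x
  proof (cases x)
    case (FinSeq xs)
    then show ?thesis
      using that by (auto simp: T2_def)
  next
    case (InfSeq f)
    let ?D = "range (\<lambda>n. FinSeq (map f [0..<n]))"
    have mono: "FinSeq (map f [0..<m]) \<le> FinSeq (map f [0..<n])" if "m \<le> n" for m n
      using that by (simp add: prefix_map_upt)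
    have "directed ?D"
      unfolding directed_def using mono by (auto intro: max.cobounded1 max.cobounded2)
    then have "?D \<inter> U \<noteq> {}"
      using U InfSeq_isLub[of f] that InfSeq unfolding scott_open_def by blast
    then obtain n where "FinSeq (map f [0..<n]) \<in> U"
      by blast
    moreover have "FinSeq (map f [0..<n]) \<le> x"
      using InfSeq by simp
    ultimately show ?thesis
      unfolding T2_def by blast
  qed
  then have "U = (\<Union>a\<in>T2 \<inter> U. {a..})"
    using U unfolding scott_open_def by auto
  then show "\<exists>S\<subseteq>T2. U = (\<Union>a\<in>S. {a..})"
    by (metis inf_le1)
next
  assume "\<exists>S\<subseteq>T2. U = (\<Union>a\<in>S. {a..})"
  then obtain S where S: "S \<subseteq> T2" and U: "U = (\<Union>a\<in>S. {a..})"
    by blast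
  have "openin L2_space {a..}" if "a \<in> S" for a
    using S that scott_open_atLeast_FinSeq by (auto simp: T2_def L2_space_def openin_scott_topology)
  then show "openin L2_space U"
    unfolding U by blast
qed

end

theory Submission
  imports Defs "HOL-Library.Countable_Set"
begin

text \<open>
  A logic is determined by countably many countermodels, so the algebra of any logic can be
  replaced by a countable subalgebra (\<open>countable_subalgebra_same_logic\<close>). Well-connectedness is
  inherited by subalgebras, and it holds for the closure algebra of \<open>L\<^sub>2\<close> because the root of the
  tree lies in the closure of every nonempty set. A subalgebra of that closure algebra therefore has
  the logic of a countable well-connected closure algebra, and a countable algebra has a copy on
  every infinite type.

  The converse rests on the fact that every countable well-connected closure algebra \<open>A\<close> embeds
  into the closure algebra of \<open>L\<^sub>2\<close> (\<open>countable_well_connected_embeds_L2\<close>). Its ultrafilter frame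
  is a preorder, and well-connectedness yields a root. Label the nodes of the binary tree by
  ultrafilters: the empty sequence gets the root, an entry \<open>0\<close> keeps the label, and an entry \<open>1\<close>
  moves to a successor containing a prescribed element of \<open>A\<close> if there is one, where every element
  is prescribed at arbitrarily large depth. Then \<open>\<diamond>x\<close> belongs to the label of a node exactly when \<open>x\<close> belongs to the
  label of some node above it.

  An infinite branch may keep climbing in the frame without ever settling in one cluster, so its
  label cannot in general be one of the labels on the branch. It is labelled by a cluster point of
  these labels in the space of ultrafilters. Along a branch the truth of \<open>\<diamond>x\<close> can only be lost, hence
  it is eventually constant and every cluster point agrees with the eventual value. This is what
  makes \<open>\<diamond>\<close> become topological closure for the Scott topology.
\<close>

section \<open>Embeddings of modal algebras\<close>

text \<open>Closure of the carrier of \<open>B\<close> under its operations is part of the notion, so that all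
  equational laws pass from \<open>A\<close> to \<open>B\<close>.\<close>

definition embedding :: "('b \<Rightarrow> 'a) \<Rightarrow> 'b modal_alg \<Rightarrow> 'a modal_alg \<Rightarrow> bool" where
  "embedding h B A \<longleftrightarrow>
     inj_on h (carrier B) \<and> h ` carrier B \<subseteq> carrier A \<and>
     bot_el B \<in> carrier B \<and> h (bot_el B) = bot_el A \<and>
     top_el B \<in> carrier B \<and> h (top_el B) = top_el A \<and>
     (\<forall>x\<in>carrier B. \<forall>y\<in>carrier B. meet B x y \<in> carrier B \<and> h (meet B x y) = meet A (h x) (h y)) \<and>
     (\<forall>x\<in>carrier B. \<forall>y\<in>carrier B. join B x y \<in> carrier B \<and> h (join B x y) = join A (h x) (h y)) \<and>
     (\<forall>x\<in>carrier B. cmpl B x \<in> carrier B \<and> h (cmpl B x) = cmpl A (h x)) \<and>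
     (\<forall>x\<in>carrier B. dia B x \<in> carrier B \<and> h (dia B x) = dia A (h x))"

lemma embedding_inj: "embedding h B A \<Longrightarrow> x \<in> carrier B \<Longrightarrow> y \<in> carrier B \<Longrightarrow> h x = h y \<longleftrightarrow> x = y"
  by (auto simp: embedding_def inj_on_def)

lemma embedding_simps:
  assumes "embedding h B A"
  shows "x \<in> carrier B \<Longrightarrow> h x \<in> carrier A"
    and "bot_el B \<in> carrier B" and "h (bot_el B) = bot_el A"
    and "top_el B \<in> carrier B" and "h (top_el B) = top_el A"
    and "x \<in> carrier B \<Longrightarrow> y \<in> carrier B \<Longrightarrow> meet B x y \<in> carrier B"
    and "x \<in> carrier B \<Longrightarrow> y \<in> carrier B \<Longrightarrow> h (meet B x y) = meet A (h x) (h y)"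
    and "x \<in> carrier B \<Longrightarrow> y \<in> carrier B \<Longrightarrow> join B x y \<in> carrier B"
    and "x \<in> carrier B \<Longrightarrow> y \<in> carrier B \<Longrightarrow> h (join B x y) = join A (h x) (h y)"
    and "x \<in> carrier B \<Longrightarrow> cmpl B x \<in> carrier B"
    and "x \<in> carrier B \<Longrightarrow> h (cmpl B x) = cmpl A (h x)"
    and "x \<in> carrier B \<Longrightarrow> dia B x \<in> carrier B"
    and "x \<in> carrier B \<Longrightarrow> h (dia B x) = dia A (h x)"
  using assms by (auto simp: embedding_def)

lemma subalgebra_imp_embedding: "subalgebra B A \<Longrightarrow> embedding (\<lambda>x. x) B A"
  by (auto simp: subalgebra_def embedding_def)

lemma embedding_modal_algebra:
  assumes "embedding h B A" "modal_algebra A"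
  shows "modal_algebra B"
proof -
  interpret modal_algebra A by fact
  note hs = embedding_simps[OF assms(1)]
  have inj: "x = y" if "h x = h y" "x \<in> carrier B" "y \<in> carrier B" for x y
    using that embedding_inj[OF assms(1)] by blast
  show ?thesis
  proof
    show "bot_el B \<noteq> top_el B"
      using nontrivial hs(3,5) by metis
  next
    fix x y z
    assume x: "x \<in> carrier B" and y: "y \<in> carrier B" and z: "z \<in> carrier B"
    show "meet B (meet B x y) z = meet B x (meet B y z)"
      by (rule inj) (simp_all add: hs x y z meet_assoc)
    show "join B (join B x y) z = join B x (join B y z)"
      by (rule inj) (simp_all add: hs x y z join_assoc)
    show "meet B x (join B y z) = join B (meet B x y) (meet B x z)"
      by (rule inj) (simp_all add: hs x y z meet_join_distrib)
    show "join B x (meet B y z) = meet B (join B x y) (join B x z)"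
      by (rule inj) (simp_all add: hs x y z join_meet_distrib)
  next
    fix x y
    assume x: "x \<in> carrier B" and y: "y \<in> carrier B"
    show "meet B x y = meet B y x"
      by (rule inj) (simp_all add: hs x y meet_commute)
    show "join B x y = join B y x"
      by (rule inj) (simp_all add: hs x y join_commute)
    show "dia B (join B x y) = join B (dia B x) (dia B y)"
      by (rule inj) (simp_all add: hs x y dia_join)
  next
    fix x assume x: "x \<in> carrier B"
    show "meet B x (top_el B) = x" "join B x (bot_el B) = x"
      "meet B x (cmpl B x) = bot_el B" "join B x (cmpl B x) = top_el B"
      by (rule inj; simp add: hs x meet_top join_bot meet_cmpl join_cmpl)+
  next
    show "dia B (bot_el B) = bot_el B"
      by (rule inj) (simp_all add: hs dia_bot)
  qed (simp_all add: hs)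
qed

lemma embedding_closure_algebra:
  assumes "embedding h B A" "closure_algebra A"
  shows "closure_algebra B"
proof -
  interpret A: closure_algebra A by fact
  interpret B: modal_algebra B
    using assms(1) A.modal_algebra_axioms by (rule embedding_modal_algebra)
  note hs = embedding_simps[OF assms(1)]
  have le: "alg_le B x y \<longleftrightarrow> alg_le A (h x) (h y)" if "x \<in> carrier B" "y \<in> carrier B" for x y
    using that embedding_inj[OF assms(1), of "meet B x y" x] by (simp add: alg_le_def hs)
  show ?thesis
    by unfold_locales (simp_all add: le hs A.dia_increasing A.dia_dia)
qed

lemma embedding_well_connected:
  assumes emb: "embedding h B A" and wc: "well_connected A"
  shows "well_connected B"
  unfolding well_connected_def
proof (intro ballI impI)
  fix a b
  assume a: "a \<in> carrier B" and b: "b \<in> carrier B" and eq: "meet B (dia B a) (dia B b) = bot_el B"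
  note hs = embedding_simps[OF emb]
  have "meet A (dia A (h a)) (dia A (h b)) = h (meet B (dia B a) (dia B b))"
    by (simp add: hs a b)
  also have "\<dots> = bot_el A"
    by (simp add: eq hs)
  finally have "h a = h (bot_el B) \<or> h b = h (bot_el B)"
    using wc hs a b by (simp add: well_connected_def)
  then show "a = bot_el B \<or> b = bot_el B"
    using embedding_inj[OF emb] hs(2) a b by blast
qed

lemma embedding_alg_eval:
  assumes "embedding h B A" "\<And>n. v n \<in> carrier B"
  shows "alg_eval B v p \<in> carrier B \<and> h (alg_eval B v p) = alg_eval A (\<lambda>n. h (v n)) p"
  by (induction p) (simp_all add: embedding_simps[OF assms(1)] assms(2))

lemma alg_logic_antimono:
  assumes emb: "embedding h B A"
  shows "alg_logic A \<subseteq> alg_logic B"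
proof
  fix p assume p: "p \<in> alg_logic A"
  have "alg_eval B v p = top_el B" if v: "\<forall>n. v n \<in> carrier B" for v
  proof -
    have "alg_eval A (\<lambda>n. h (v n)) p = top_el A"
      using p v by (simp add: alg_logic_def alg_valid_def embedding_simps[OF emb])
    then show ?thesis
      using embedding_alg_eval[OF emb, of v p] v embedding_inj[OF emb]
      by (metis embedding_simps(4,5)[OF emb])
  qed
  then show "p \<in> alg_logic B"
    by (simp add: alg_logic_def alg_valid_def)
qed

lemma alg_logic_isomorphic:
  assumes emb: "embedding h B A" and surj: "h ` carrier B = carrier A"
  shows "alg_logic B = alg_logic A"
proof
  show "alg_logic B \<subseteq> alg_logic A"
  proof
    fix p assume p: "p \<in> alg_logic B"
    have "alg_eval A v p = top_el A" if v: "\<forall>n. v n \<in> carrier A" for v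
    proof -
      let ?w = "\<lambda>n. inv_into (carrier B) h (v n)"
      have w: "?w n \<in> carrier B" "h (?w n) = v n" for n
        using v surj by (simp_all add: inv_into_into f_inv_into_f)
      have "alg_eval B ?w p = top_el B"
        using p w by (simp add: alg_logic_def alg_valid_def)
      then show ?thesis
        using embedding_alg_eval[OF emb, of ?w p] w embedding_simps(5)[OF emb] by simp
    qed
    then show "p \<in> alg_logic A"
      by (simp add: alg_logic_def alg_valid_def)
  qed
qed (rule alg_logic_antimono[OF emb])

text \<open>Transporting the operations along an injection gives a copy on any type large
  enough to hold the carrier.\<close>

lemma embedding_copy:
  fixes A :: "'a modal_alg" and g :: "'a \<Rightarrow> 'b"
  assumes "modal_algebra A" and inj: "inj_on g (carrier A)"
  shows "\<exists>(B :: 'b modal_alg) h. embedding h B A \<and> h ` carrier B = carrier A"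
proof -
  interpret modal_algebra A by fact
  define h where "h = inv_into (carrier A) g"
  have hg [simp]: "h (g x) = x" if "x \<in> carrier A" for x
    using inj that by (simp add: h_def)
  define B where "B = \<lparr> carrier = g ` carrier A,
     meet = (\<lambda>x y. g (meet A (h x) (h y))), join = (\<lambda>x y. g (join A (h x) (h y))),
     cmpl = (\<lambda>x. g (cmpl A (h x))), bot_el = g (bot_el A), top_el = g (top_el A),
     dia = (\<lambda>x. g (dia A (h x))) \<rparr>"
  have "embedding h B A"
    unfolding embedding_def B_def
    by (auto simp: inj_on_def meet_closed join_closed cmpl_closed bot_closed top_closed dia_closed)
  moreover have "h ` carrier B = carrier A"
    by (force simp: B_def)
  ultimately show ?thesis by blast
qed


section \<open>Countable subalgebras with the same logic\<close>

instance fm :: countable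
  by countable_datatype

text \<open>A downward Loewenheim--Skolem argument: one valuation can list all the values taken by
  countermodels to the countably many non-valid formulas, and the values of all formulas under it
  form the subalgebra generated by these elements.\<close>

lemma (in modal_algebra) countable_subalgebra_same_logic:
  "\<exists>B. subalgebra B A \<and> countable (carrier B) \<and> alg_logic B = alg_logic A"
proof -
  have "\<exists>w. (\<forall>n. w n \<in> carrier A) \<and> (p \<in> alg_logic A \<or> alg_eval A w p \<noteq> top_el A)" for p
  proof (cases "p \<in> alg_logic A")
    case True
    then show ?thesis
      using bot_closed by (intro exI[of _ "\<lambda>_. bot_el A"]) simp
  next
    case False
    then show ?thesis
      unfolding alg_logic_def alg_valid_def by blast
  qed
  then obtain w where w: "\<And>p n. w p n \<in> carrier A"
    and refutes: "\<And>p. p \<notin> alg_logic A \<Longrightarrow> alg_eval A (w p) p \<noteq> top_el A"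
    by metis
  (* The letter coded by (p, n) takes the value of letter n in the countermodel chosen for p. *)
  define v where "v k = w (from_nat (fst (prod_decode k))) (snd (prod_decode k))" for k
  have v: "v n \<in> carrier A" for n
    by (simp add: v_def w)
  have v_code: "v (prod_encode (to_nat p, n)) = w p n" for p n
    by (simp add: v_def)
  define B where "B = A\<lparr>carrier := range (alg_eval A v)\<rparr>"
  have "alg_eval A v p \<in> carrier A" for p
    by (induction p)
      (simp_all add: v meet_closed join_closed cmpl_closed bot_closed top_closed dia_closed)
  moreover have "bot_el A \<in> range (alg_eval A v)"
    by (rule range_eqI[of _ _ FFalse]) simp
  moreover have "top_el A \<in> range (alg_eval A v)"
    by (rule range_eqI[of _ _ FTrue]) simp
  moreover have "meet A (alg_eval A v p) (alg_eval A v q) \<in> range (alg_eval A v)" for p q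
    by (rule range_eqI[of _ _ "Conj p q"]) simp
  moreover have "join A (alg_eval A v p) (alg_eval A v q) \<in> range (alg_eval A v)" for p q
    by (rule range_eqI[of _ _ "Disj p q"]) simp
  moreover have "cmpl A (alg_eval A v p) \<in> range (alg_eval A v)" for p
    by (rule range_eqI[of _ _ "Neg p"]) simp
  moreover have "dia A (alg_eval A v p) \<in> range (alg_eval A v)" for p
    by (rule range_eqI[of _ _ "Dia p"]) simp
  ultimately have sub: "subalgebra B A"
    by (auto simp: subalgebra_def B_def)
  have ev: "alg_eval B u p = alg_eval A u p" for u p
    by (induction p) (simp_all add: B_def)
  have "p \<in> alg_logic A" if p: "p \<in> alg_logic B" for p
  proof (rule ccontr)
    assume np: "p \<notin> alg_logic A"
    have "w p n \<in> range (alg_eval A v)" for n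
      by (rule range_eqI[of _ _ "Letter (prod_encode (to_nat p, n))"]) (simp add: v_code)
    then have "w p n \<in> carrier B" for n
      by (simp add: B_def)
    then have "alg_eval A (w p) p = top_el A"
      using p by (simp add: alg_logic_def alg_valid_def ev) (simp add: B_def)
    then show False
      using refutes[OF np] by blast
  qed
  then have "alg_logic B = alg_logic A"
    using alg_logic_antimono[OF subalgebra_imp_embedding[OF sub]] by blast
  moreover have "countable (carrier B)"
    by (simp add: B_def)
  ultimately show ?thesis
    using sub by blast
qed


section \<open>Ultrafilters\<close>

context modal_algebra
begin

lemma meet_idem: assumes x: "x \<in> carrier A" shows "meet A x x = x"
  using meet_join_distrib[of x x "cmpl A x"] x
  by (simp add: cmpl_closed meet_closed meet_cmpl join_cmpl meet_top join_bot)

lemma join_top: assumes x: "x \<in> carrier A" shows "join A x (top_el A) = top_el A"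
proof -
  have "join A x (top_el A) = meet A (join A x (cmpl A x)) (join A x (top_el A))"
    by (metis x join_closed top_closed join_cmpl meet_commute meet_top)
  also have "\<dots> = join A x (meet A (cmpl A x) (top_el A))"
    using x by (simp add: join_meet_distrib cmpl_closed top_closed)
  finally show ?thesis
    using x by (simp add: meet_top cmpl_closed join_cmpl)
qed

lemma absorb:
  assumes x: "x \<in> carrier A" and y: "y \<in> carrier A"
  shows "meet A x (join A x y) = x" "join A x (meet A x y) = x"
proof -
  have "join A x (meet A x y) = meet A x (join A (top_el A) y)"
    using x y by (simp add: meet_join_distrib top_closed meet_top)
  also have "join A (top_el A) y = top_el A"
    using join_commute[OF top_closed y] join_top[OF y] by simp
  finally show *: "join A x (meet A x y) = x"
    using x by (simp add: meet_top)
  show "meet A x (join A x y) = x"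
    using x y * by (simp add: meet_join_distrib meet_idem)
qed

lemma meet_bot: assumes x: "x \<in> carrier A" shows "meet A x (bot_el A) = bot_el A"
  using absorb(1)[OF bot_closed x] join_bot[OF x] join_commute[OF bot_closed x]
    meet_commute[OF bot_closed x] by simp

lemma le_iff_join:
  "\<lbrakk>x \<in> carrier A; y \<in> carrier A\<rbrakk> \<Longrightarrow> alg_le A x y \<longleftrightarrow> join A x y = y"
  unfolding alg_le_def
  using absorb(1)[of x y] absorb(2)[of y x] join_commute[of x y] meet_commute[of x y] by auto

lemma le_iff_meet_cmpl:
  assumes x: "x \<in> carrier A" and y: "y \<in> carrier A"
  shows "alg_le A x y \<longleftrightarrow> meet A x (cmpl A y) = bot_el A"
proof
  assume "alg_le A x y"
  then have "meet A x (cmpl A y) = meet A (meet A x y) (cmpl A y)"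
    by (simp add: alg_le_def)
  then show "meet A x (cmpl A y) = bot_el A"
    using x y by (simp add: meet_assoc cmpl_closed meet_cmpl meet_bot)
next
  assume "meet A x (cmpl A y) = bot_el A"
  then have "meet A x (join A y (cmpl A y)) = meet A x y"
    using x y by (simp add: meet_join_distrib cmpl_closed join_bot meet_closed)
  then show "alg_le A x y"
    using x y by (simp add: alg_le_def join_cmpl meet_top)
qed

lemma dia_mono:
  assumes "alg_le A x y" "x \<in> carrier A" "y \<in> carrier A"
  shows "alg_le A (dia A x) (dia A y)"
  using assms dia_join[of x y] by (simp add: dia_closed le_iff_join)

definition proper_filter :: "'a set \<Rightarrow> bool" where
  "proper_filter F \<longleftrightarrow> F \<subseteq> carrier A \<and> top_el A \<in> F \<and> bot_el A \<notin> F \<and>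
     (\<forall>x\<in>F. \<forall>y\<in>F. meet A x y \<in> F) \<and> (\<forall>x\<in>F. \<forall>y\<in>carrier A. join A x y \<in> F)"

definition ultrafilter :: "'a set \<Rightarrow> bool" where
  "ultrafilter u \<longleftrightarrow> proper_filter u \<and> (\<forall>x\<in>carrier A. x \<in> u \<or> cmpl A x \<in> u)"

lemma filter_mono:
  assumes F: "proper_filter F" and x: "x \<in> F" and le: "alg_le A x y" and y: "y \<in> carrier A"
  shows "y \<in> F"
proof -
  have "x \<in> carrier A" "join A x y \<in> F"
    using F x y by (auto simp: proper_filter_def)
  then show ?thesis
    using le y by (simp add: le_iff_join)
qed

text \<open>If neither \<open>x\<close> nor its complement lay in a maximal proper filter \<open>M\<close>, then the filter of
  all \<open>c\<close> with \<open>x \<rightarrow> c\<close> in \<open>M\<close> would be proper and properly larger.\<close>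

lemma ultrafilter_extension:
  assumes "proper_filter F"
  shows "\<exists>u. ultrafilter u \<and> F \<subseteq> u"
proof -
  let ?S = "{G. proper_filter G \<and> F \<subseteq> G}"
  have "\<exists>M\<in>?S. \<forall>X\<in>?S. M \<subseteq> X \<longrightarrow> X = M"
  proof (rule subset_Zorn_nonempty)
    show "?S \<noteq> {}" using assms by blast
    fix C assume "C \<noteq> {}" and C: "subset.chain ?S C"
    then obtain G where G: "G \<in> C" by blast
    have sub: "\<And>G. G \<in> C \<Longrightarrow> proper_filter G \<and> F \<subseteq> G"
      using C by (auto simp: subset.chain_def)
    have "\<exists>H\<in>C. x \<in> H \<and> y \<in> H" if "x \<in> \<Union>C" "y \<in> \<Union>C" for x y
      using that C by (meson UnionE subsetD subset_chain_def)
    then have "\<forall>x\<in>\<Union>C. \<forall>y\<in>\<Union>C. meet A x y \<in> \<Union>C"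
      using sub unfolding proper_filter_def by (meson UnionI)
    moreover have "\<Union>C \<subseteq> carrier A" "top_el A \<in> \<Union>C" "bot_el A \<notin> \<Union>C"
      using sub G unfolding proper_filter_def by blast+
    moreover have "\<forall>x\<in>\<Union>C. \<forall>y\<in>carrier A. join A x y \<in> \<Union>C"
      using sub unfolding proper_filter_def by (meson UnionE UnionI)
    ultimately have "proper_filter (\<Union>C)"
      unfolding proper_filter_def by blast
    then show "\<Union>C \<in> ?S" using sub G by blast
  qed
  then obtain M where M: "proper_filter M" and FM: "F \<subseteq> M"
    and max: "\<And>X. proper_filter X \<Longrightarrow> M \<subseteq> X \<Longrightarrow> X = M"
    by (metis (mono_tags, lifting) mem_Collect_eq order_trans)
  have "cmpl A x \<in> M" if x: "x \<in> carrier A" and notin: "x \<notin> M" for x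
  proof (rule ccontr)
    assume n: "cmpl A x \<notin> M"
    let ?N = "{c \<in> carrier A. join A (cmpl A x) c \<in> M}"
    note cl = x cmpl_closed join_closed meet_closed top_closed bot_closed
    have MN: "M \<subseteq> ?N"
      using M x by (auto simp: proper_filter_def join_commute[OF cmpl_closed] cmpl_closed subset_eq)
    have "proper_filter ?N"
      unfolding proper_filter_def
    proof (intro conjI ballI)
      show "bot_el A \<notin> ?N"
        using n x by (simp add: join_bot cmpl_closed)
      show "top_el A \<in> ?N"
        using MN M by (auto simp: proper_filter_def)
      show "meet A c d \<in> ?N" if "c \<in> ?N" "d \<in> ?N" for c d
        using that M x by (simp add: proper_filter_def cl join_meet_distrib)
      show "join A c d \<in> ?N" if "c \<in> ?N" "d \<in> carrier A" for c d
        using that M x by (simp add: proper_filter_def cl join_assoc[symmetric])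
    qed simp
    then have "?N = M" using MN max by blast
    moreover have "x \<in> ?N"
      using M x by (simp add: proper_filter_def cl join_commute[of "cmpl A x"] join_cmpl)
    ultimately show False using notin by blast
  qed
  then show ?thesis
    using M FM unfolding ultrafilter_def by blast
qed

lemma ultrafilter_simps:
  assumes u: "ultrafilter u"
  shows "bot_el A \<notin> u" "top_el A \<in> u"
    "x \<in> carrier A \<Longrightarrow> cmpl A x \<in> u \<longleftrightarrow> x \<notin> u"
    "x \<in> carrier A \<Longrightarrow> y \<in> carrier A \<Longrightarrow> meet A x y \<in> u \<longleftrightarrow> x \<in> u \<and> y \<in> u"
    "x \<in> carrier A \<Longrightarrow> y \<in> carrier A \<Longrightarrow> join A x y \<in> u \<longleftrightarrow> x \<in> u \<or> y \<in> u"
proof -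
  have F: "proper_filter u" using u by (simp add: ultrafilter_def)
  show bt: "bot_el A \<notin> u" "top_el A \<in> u"
    using F by (auto simp: proper_filter_def)
  show c: "cmpl A x \<in> u \<longleftrightarrow> x \<notin> u" if "x \<in> carrier A" for x
    using u F that bt(1) meet_cmpl[OF that] unfolding ultrafilter_def proper_filter_def by metis
  show m: "meet A x y \<in> u \<longleftrightarrow> x \<in> u \<and> y \<in> u" if xy: "x \<in> carrier A" "y \<in> carrier A" for x y
  proof
    assume m: "meet A x y \<in> u"
    have "join A (meet A x y) x = x" "join A (meet A x y) y = y"
      using xy absorb(2) by (metis join_commute meet_closed meet_commute)+
    then show "x \<in> u \<and> y \<in> u"
      using F m xy unfolding proper_filter_def by metis
  qed (use F in \<open>auto simp: proper_filter_def\<close>)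
  show "join A x y \<in> u \<longleftrightarrow> x \<in> u \<or> y \<in> u" if xy: "x \<in> carrier A" "y \<in> carrier A"
  proof
    assume j: "join A x y \<in> u"
    show "x \<in> u \<or> y \<in> u"
    proof (rule ccontr)
      assume "\<not> (x \<in> u \<or> y \<in> u)"
      then have "x \<notin> u" and y: "cmpl A y \<in> u"
        using c xy by auto
      have "meet A (cmpl A y) (join A x y) = meet A (cmpl A y) x"
        using xy meet_cmpl[of y]
        by (simp add: meet_join_distrib cmpl_closed meet_commute[of "cmpl A y" y] join_bot meet_closed)
      moreover have "meet A (cmpl A y) (join A x y) \<in> u"
        using m[OF cmpl_closed join_closed] xy y j by blast
      ultimately show False
        using m[OF cmpl_closed] xy \<open>x \<notin> u\<close> by metis
    qed
  next
    assume "x \<in> u \<or> y \<in> u"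
    then show "join A x y \<in> u"
      using F xy join_commute[OF xy] unfolding proper_filter_def by metis
  qed
qed

lemma ultrafilter_carrier: "ultrafilter u \<Longrightarrow> u \<subseteq> carrier A"
  by (simp add: ultrafilter_def proper_filter_def)

lemma ultrafilter_mono:
  "\<lbrakk>ultrafilter u; x \<in> u; alg_le A x y; y \<in> carrier A\<rbrakk> \<Longrightarrow> y \<in> u"
  using filter_mono[of u x y] by (simp add: ultrafilter_def)

lemma nonzero_in_ultrafilter:
  assumes z: "z \<in> carrier A" "z \<noteq> bot_el A"
  shows "\<exists>u. ultrafilter u \<and> z \<in> u"
proof -
  let ?F = "{c \<in> carrier A. meet A z c = z}"
  have "proper_filter ?F"
    unfolding proper_filter_def
  proof (intro conjI ballI)
    show "meet A c d \<in> ?F" if "c \<in> ?F" "d \<in> ?F" for c d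
      using that z by (simp add: meet_closed meet_assoc[symmetric])
    show "join A c d \<in> ?F" if "c \<in> ?F" "d \<in> carrier A" for c d
      using that z by (simp add: join_closed meet_join_distrib absorb)
  qed (use z in \<open>auto simp: top_closed meet_top meet_bot\<close>)
  then show ?thesis
    using ultrafilter_extension z meet_idem by blast
qed

text \<open>Ultrafilters decide the order (Stone), which reduces Boolean laws to propositional logic.\<close>

lemma alg_le_iff_ultrafilter:
  assumes x: "x \<in> carrier A" and y: "y \<in> carrier A"
  shows "alg_le A x y \<longleftrightarrow> (\<forall>u. ultrafilter u \<longrightarrow> x \<in> u \<longrightarrow> y \<in> u)"
proof
  assume R: "\<forall>u. ultrafilter u \<longrightarrow> x \<in> u \<longrightarrow> y \<in> u"
  have "meet A x (cmpl A y) = bot_el A"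
  proof (rule ccontr)
    assume "\<not> ?thesis"
    then obtain u where u: "ultrafilter u" "meet A x (cmpl A y) \<in> u"
      using nonzero_in_ultrafilter[OF meet_closed[OF x cmpl_closed[OF y]]] by blast
    then show False
      using R by (auto simp: ultrafilter_simps x y cmpl_closed)
  qed
  then show "alg_le A x y"
    by (simp add: le_iff_meet_cmpl x y)
qed (use ultrafilter_mono y in blast)

lemma alg_le_antisym:
  "\<lbrakk>alg_le A x y; alg_le A y x; x \<in> carrier A; y \<in> carrier A\<rbrakk> \<Longrightarrow> x = y"
  using meet_commute[of x y] by (simp add: alg_le_def)

text \<open>The accessibility relation of the ultrafilter frame of \<open>A\<close>.\<close>

definition sees :: "'a set \<Rightarrow> 'a set \<Rightarrow> bool" where
  "sees u w \<longleftrightarrow> (\<forall>x\<in>w. dia A x \<in> u)"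

text \<open>The successor has to contain every \<open>c\<close> for which \<open>a \<and> \<not>c\<close> is not possible at \<open>u\<close>; these
  \<open>c\<close> form a proper filter containing \<open>a\<close>, and any ultrafilter extending it is seen by \<open>u\<close>.\<close>

lemma ultrafilter_successor:
  assumes u: "ultrafilter u" and a: "a \<in> carrier A" and dia: "dia A a \<in> u"
  shows "\<exists>w. ultrafilter w \<and> sees u w \<and> a \<in> w"
proof -
  let ?F = "{c \<in> carrier A. dia A (meet A a (cmpl A c)) \<notin> u}"
  note cl = a cmpl_closed join_closed meet_closed top_closed bot_closed dia_closed
  note us = ultrafilter_simps
  have down: "dia A x \<notin> u"
    if "\<And>v. ultrafilter v \<Longrightarrow> x \<in> v \<Longrightarrow> y \<in> v" "dia A y \<notin> u" "x \<in> carrier A" "y \<in> carrier A" for x y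
    using that ultrafilter_mono[OF u] dia_mono alg_le_iff_ultrafilter by (meson dia_closed)
  have "proper_filter ?F"
    unfolding proper_filter_def
  proof (intro conjI ballI)
    show "top_el A \<in> ?F"
      using down[of "meet A a (cmpl A (top_el A))" "bot_el A"] u by (simp add: cl us dia_bot)
    show "bot_el A \<notin> ?F"
      using down[of a "meet A a (cmpl A (bot_el A))"] dia by (auto simp add: cl us)
    show "meet A c d \<in> ?F" if "c \<in> ?F" "d \<in> ?F" for c d
      using that u
        down[of "meet A a (cmpl A (meet A c d))" "join A (meet A a (cmpl A c)) (meet A a (cmpl A d))"]
      by (simp add: cl us dia_join)
    show "join A c d \<in> ?F" if "c \<in> ?F" "d \<in> carrier A" for c d
      using that down[of "meet A a (cmpl A (join A c d))" "meet A a (cmpl A c)"]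
      by (simp add: cl us)
  qed simp
  then obtain w where w: "ultrafilter w" and Fw: "?F \<subseteq> w"
    using ultrafilter_extension by blast
  have "a \<in> ?F"
    using a u by (simp add: meet_cmpl dia_bot us)
  moreover have "dia A x \<in> u" if x: "x \<in> w" for x
  proof (rule ccontr)
    assume "dia A x \<notin> u"
    moreover have xA: "x \<in> carrier A"
      using ultrafilter_carrier[OF w] x by blast
    ultimately have "cmpl A x \<in> ?F"
      using down[of "meet A a (cmpl A (cmpl A x))" x] by (simp add: cl us)
    then show False
      using Fw w x xA us(3) by blast
  qed
  ultimately show ?thesis
    using w Fw unfolding sees_def by blast
qed

text \<open>Compactness of the space of ultrafilters: the elements that eventually belong to \<open>w i\<close> form a
  proper filter, and any ultrafilter extending it is a cluster point.\<close>

lemma ultrafilter_cluster_point: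
  assumes w: "\<And>i. ultrafilter (w i)" and "N \<noteq> bot"
  shows "\<exists>u. ultrafilter u \<and> (\<forall>x\<in>carrier A. (\<forall>\<^sub>F i in N. x \<in> w i) \<longrightarrow> x \<in> u)"
proof -
  let ?F = "{x \<in> carrier A. \<forall>\<^sub>F i in N. x \<in> w i}"
  have "proper_filter ?F"
    unfolding proper_filter_def
  proof (intro conjI ballI)
    show "meet A c d \<in> ?F" if "c \<in> ?F" "d \<in> ?F" for c d
      using that eventually_conj[of "\<lambda>i. c \<in> w i" N "\<lambda>i. d \<in> w i"]
      by (simp add: meet_closed ultrafilter_simps[OF w])
    show "join A c d \<in> ?F" if "c \<in> ?F" "d \<in> carrier A" for c d
      using that by (auto simp: join_closed ultrafilter_simps[OF w] elim: eventually_mono)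
  qed (use assms in \<open>auto simp: top_closed ultrafilter_simps[OF w]\<close>)
  then show ?thesis
    using ultrafilter_extension by blast
qed

end

context closure_algebra
begin

lemma sees_refl:
  assumes u: "ultrafilter u"
  shows "sees u u"
  unfolding sees_def
proof
  fix x assume x: "x \<in> u"
  then have "x \<in> carrier A"
    using ultrafilter_carrier[OF u] by blast
  then show "dia A x \<in> u"
    using ultrafilter_mono[OF u x] by (simp add: dia_increasing dia_closed)
qed

lemma sees_trans:
  assumes u: "ultrafilter u" and w: "ultrafilter w" and uv: "sees u v" and vw: "sees v w"
  shows "sees u w"
  unfolding sees_def
proof
  fix x assume x: "x \<in> w"
  then have "x \<in> carrier A"
    using ultrafilter_carrier[OF w] by blast
  moreover have "dia A (dia A x) \<in> u"
    using x uv vw by (simp add: sees_def)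
  ultimately show "dia A x \<in> u"
    using ultrafilter_mono[OF u] by (simp add: dia_dia dia_closed)
qed

text \<open>Well-connectedness makes the elements above some \<open>\<diamond>a\<close> with \<open>a \<noteq> 0\<close> a filter, because
  \<open>\<diamond>a \<and> \<diamond>b\<close> is nonzero and closed.\<close>

lemma well_connected_root:
  assumes wc: "well_connected A"
  shows "\<exists>r. ultrafilter r \<and> (\<forall>a\<in>carrier A. a \<noteq> bot_el A \<longrightarrow> dia A a \<in> r)"
proof -
  let ?F = "{c \<in> carrier A. \<exists>a\<in>carrier A. a \<noteq> bot_el A \<and> alg_le A (dia A a) c}"
  have "proper_filter ?F"
    unfolding proper_filter_def
  proof (intro conjI ballI)
    show "top_el A \<in> ?F"
      using nontrivial by (auto simp: top_closed alg_le_def meet_top dia_closed intro!: bexI[of _ "top_el A"])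
    show "bot_el A \<notin> ?F"
    proof
      assume "bot_el A \<in> ?F"
      then obtain a where a: "a \<in> carrier A" "a \<noteq> bot_el A" "alg_le A (dia A a) (bot_el A)"
        by blast
      obtain u where u: "ultrafilter u" "a \<in> u"
        using nonzero_in_ultrafilter a by blast
      then have "dia A a \<in> u"
        using sees_refl by (auto simp: sees_def)
      then show False
        using ultrafilter_mono a(3) bot_closed u(1) ultrafilter_simps(1) by blast
    qed
    show "meet A c d \<in> ?F" if cF: "c \<in> ?F" and dF: "d \<in> ?F" for c d
    proof -
      obtain a b where a: "a \<in> carrier A" "a \<noteq> bot_el A" "alg_le A (dia A a) c"
        and b: "b \<in> carrier A" "b \<noteq> bot_el A" "alg_le A (dia A b) d"
        using cF dF by blast
      let ?m = "meet A (dia A a) (dia A b)"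
      (* The meet of two closed elements witnesses itself: its own closure lies below both. *)
      have m: "?m \<in> carrier A" "?m \<noteq> bot_el A"
        using wc a b by (auto simp: well_connected_def meet_closed dia_closed)
      have "alg_le A (dia A ?m) c"  if "alg_le A ?m (dia A x)" "alg_le A (dia A x) c"
          "x \<in> carrier A" "c \<in> carrier A" for x c
        using dia_mono[OF that(1)] dia_dia[OF that(3)] that m
        by (simp add: dia_closed alg_le_iff_ultrafilter)
      moreover have "alg_le A ?m (dia A a)" "alg_le A ?m (dia A b)"
        using a b m by (simp_all add: alg_le_iff_ultrafilter dia_closed ultrafilter_simps)
      ultimately have "alg_le A (dia A ?m) c" "alg_le A (dia A ?m) d"
        using a b cF dF by blast+
      then have "alg_le A (dia A ?m) (meet A c d)"
        using cF dF m by (simp add: alg_le_iff_ultrafilter dia_closed ultrafilter_simps meet_closed)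
      then show ?thesis
        using cF dF m meet_closed by blast
    qed
    show "join A c d \<in> ?F" if "c \<in> ?F" "d \<in> carrier A" for c d
      using that by (fastforce simp: alg_le_iff_ultrafilter join_closed dia_closed ultrafilter_simps)
  qed simp
  then obtain r where r: "ultrafilter r" and Fr: "?F \<subseteq> r"
    using ultrafilter_extension by blast
  have "dia A a \<in> ?F" if "a \<in> carrier A" "a \<noteq> bot_el A" for a
    using that by (auto simp: alg_le_def meet_idem dia_closed)
  then show ?thesis
    using r Fr by blast
qed

end


section \<open>Embedding countable well-connected closure algebras\<close>

text \<open>A list records the path from the root backwards. An entry \<open>0\<close> means to wait, an entry \<open>1\<close> at
  depth \<open>k\<close> means to move by \<open>f k\<close>; by waiting one can choose which move to make.\<close>

primrec walk :: "'u \<Rightarrow> (nat \<Rightarrow> 'u \<Rightarrow> 'u) \<Rightarrow> bool list \<Rightarrow> 'u" where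
  "walk r f [] = r"
| "walk r f (b # s) = (if b then f (length s) (walk r f s) else walk r f s)"

lemma walk_wait: "walk r f (replicate m False @ s) = walk r f s"
  by (induction m) simp_all

lemma L2_closure_of:
  "s \<in> L2_space closure_of S \<longleftrightarrow> (\<forall>xs. FinSeq xs \<le> s \<longrightarrow> (\<exists>t\<in>S. FinSeq xs \<le> t))"
proof
  assume s: "s \<in> L2_space closure_of S"
  show "\<forall>xs. FinSeq xs \<le> s \<longrightarrow> (\<exists>t\<in>S. FinSeq xs \<le> t)"
  proof (intro allI impI)
    fix xs assume "FinSeq xs \<le> s"
    then show "\<exists>t\<in>S. FinSeq xs \<le> t"
      using s scott_open_atLeast_FinSeq[of xs]
      by (auto simp: in_closure_of L2_space_def openin_scott_topology dest: spec[of _ "{FinSeq xs..}"])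
  qed
next
  assume R: "\<forall>xs. FinSeq xs \<le> s \<longrightarrow> (\<exists>t\<in>S. FinSeq xs \<le> t)"
  have "\<exists>y. y \<in> S \<and> y \<in> U" if sU: "s \<in> U" and U: "openin L2_space U" for U
  proof -
    obtain T where T: "T \<subseteq> T2" "U = (\<Union>a\<in>T. {a..})"
      using U unfolding openin_L2_space_basis by (elim exE conjE)
    then obtain a where a: "a \<in> T" "a \<le> s"
      using sU by auto
    then obtain xs where "a = FinSeq xs"
      using T(1) by (auto simp: T2_def)
    then obtain t where "t \<in> S" "a \<le> t"
      using R a(2) by blast
    then show ?thesis
      using T(2) a(1) by auto
  qed
  then show "s \<in> L2_space closure_of S"
    by (auto simp: in_closure_of topspace_L2_space)
qed

text \<open>The labelling \<open>pt\<close> of \<open>L\<^sub>2\<close> by ultrafilters induces the embedding \<open>x \<mapsto> {s. x \<in> pt s}\<close>. That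
  \<open>\<diamond>\<close> becomes closure is immediate at finite sequences. At an infinite branch, closure asks for
  \<open>\<diamond>x\<close> in the labels of all nodes below, and \<open>dia_node\<close> and the choice of the label as a cluster
  point turn this into \<open>\<diamond>x\<close> in the label of the branch.\<close>

theorem (in closure_algebra) countable_well_connected_embeds_L2:
  assumes wc: "well_connected A" and countable: "countable (carrier A)"
  shows "\<exists>h. embedding h A (space_alg L2_space)"
proof -
  (* Decoding pairs makes the enumeration hit every element at arbitrarily large indices. *)
  define e where "e j = from_nat_into (carrier A) (fst (prod_decode j))" for j
  have e_closed: "e j \<in> carrier A" for j
    unfolding e_def by (rule from_nat_into) (use bot_closed in auto)
  have e_often: "\<exists>j\<ge>k. e j = x" if x: "x \<in> carrier A" for x k
  proof -
    obtain i where "from_nat_into (carrier A) i = x"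
      using from_nat_into_surj[OF countable x] by blast
    then have "e (prod_encode (i, k)) = x"
      by (simp add: e_def)
    then show ?thesis
      using le_prod_encode_2 by blast
  qed
  obtain r where r: "ultrafilter r" and root: "\<And>a. a \<in> carrier A \<Longrightarrow> a \<noteq> bot_el A \<Longrightarrow> dia A a \<in> r"
    using well_connected_root[OF wc] by blast
  have "\<forall>k u. \<exists>w. ultrafilter u \<longrightarrow> ultrafilter w \<and> sees u w \<and> (dia A (e k) \<in> u \<longrightarrow> e k \<in> w)"
    using ultrafilter_successor[OF _ e_closed] sees_refl by blast
  then obtain step where step: "\<And>k u. ultrafilter u \<Longrightarrow> ultrafilter (step k u) \<and> sees u (step k u) \<and>
      (dia A (e k) \<in> u \<longrightarrow> e k \<in> step k u)"
    unfolding choice_iff by blast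
  define node where "node xs = walk r step (rev xs)" for xs
  have ultra_node: "ultrafilter (node xs)" for xs
    unfolding node_def by (induction xs rule: rev_induct) (auto simp: r step)
  have node_sees: "sees (node xs) (node (xs @ ys))" for xs ys
  proof (induction ys rule: rev_induct)
    case Nil
    show ?case by (simp add: sees_refl ultra_node)
  next
    case (snoc b ys)
    have "sees (node (xs @ ys)) (node (xs @ ys @ [b]))"
      using step ultra_node[of "xs @ ys"] sees_refl by (simp add: node_def)
    then show ?case
      using snoc sees_trans ultra_node by blast
  qed
  have node_reaches: "\<exists>ys. x \<in> node (xs @ ys)" if x: "x \<in> carrier A" and dia: "dia A x \<in> node xs" for x xs
  proof -
    obtain m where m: "e (length xs + m) = x"
      using e_often[OF x, of "length xs"] by (metis le_Suc_ex)
    have "node (xs @ replicate m False @ [True]) = step (length xs + m) (node xs)"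
      by (simp add: node_def walk_wait add.commute)
    then have "x \<in> node (xs @ replicate m False @ [True])"
      using step ultra_node dia m by metis
    then show ?thesis by blast
  qed
  (* An infinite sequence is labelled by a cluster point of the labels of its initial segments. *)
  have "\<exists>u. ultrafilter u \<and>
      (\<forall>x\<in>carrier A. (\<forall>\<^sub>F n in sequentially. x \<in> node (map b [0..<n])) \<longrightarrow> x \<in> u)" for b
    by (rule ultrafilter_cluster_point) (simp_all add: ultra_node)
  then obtain branch where ultra_branch: "\<And>b. ultrafilter (branch b)"
    and branch: "\<And>b x. x \<in> carrier A \<Longrightarrow> \<forall>\<^sub>F n in sequentially. x \<in> node (map b [0..<n]) \<Longrightarrow> x \<in> branch b"
    by metis
  define pt where "pt s = (case s of FinSeq xs \<Rightarrow> node xs | InfSeq b \<Rightarrow> branch b)" for s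
  have ultra_pt: "ultrafilter (pt s)" for s
    by (simp add: pt_def ultra_node ultra_branch split: binseq.split)
  have pt_closed: "x \<in> carrier A" if "x \<in> pt s" for x s
    using ultrafilter_carrier[OF ultra_pt] that by blast
  have sees_pt: "sees (node xs) (pt t)" if le: "FinSeq xs \<le> t" for xs t
  proof (cases t)
    case (FinSeq ys)
    then show ?thesis
      using le node_sees by (auto simp: pt_def prefix_def)
  next
    case (InfSeq b)
    have xs: "xs = map b [0..<length xs]"
      using le InfSeq by (auto intro: nth_equalityI)
    have "dia A x \<in> node xs" if x: "x \<in> branch b" for x
    proof -
      have xA: "x \<in> carrier A"
        using x pt_closed[of x "InfSeq b"] by (simp add: pt_def)
      (* Otherwise the complement of x would eventually hold along b, hence hold at the branch. *)
      have "\<exists>n\<ge>length xs. x \<in> node (map b [0..<n])"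
      proof (rule ccontr)
        assume "\<not> ?thesis"
        then have "\<forall>\<^sub>F n in sequentially. cmpl A x \<in> node (map b [0..<n])"
          by (intro eventually_sequentiallyI[of "length xs"])
            (simp add: ultrafilter_simps(3)[OF ultra_node xA])
        then have "cmpl A x \<in> branch b"
          using branch xA cmpl_closed by blast
        then show False
          using x xA ultra_branch ultrafilter_simps(3) by blast
      qed
      then obtain n where n: "length xs \<le> n" "x \<in> node (map b [0..<n])" by blast
      then have "prefix xs (map b [0..<n])"
        using prefix_map_upt[OF n(1), of b] xs by simp
      then show ?thesis
        using n(2) node_sees by (auto simp: prefix_def sees_def)
    qed
    then show ?thesis
      using InfSeq by (simp add: sees_def pt_def)
  qed
  have dia_node: "dia A x \<in> node xs" if "FinSeq xs \<le> t" "dia A x \<in> pt t" "x \<in> carrier A" for x xs t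
  proof -
    have "dia A (dia A x) \<in> node xs"
      using sees_pt that by (auto simp: sees_def)
    then show ?thesis
      using ultrafilter_mono[OF ultra_node] dia_dia dia_closed that by blast
  qed
  define h where "h x = {s. x \<in> pt s}" for x
  have h_dia: "h (dia A x) = L2_space closure_of h x" if x: "x \<in> carrier A" for x
  proof (intro set_eqI iffI)
    fix s assume s: "s \<in> h (dia A x)"
    show "s \<in> L2_space closure_of h x"
      unfolding L2_closure_of
    proof (intro allI impI)
      fix xs assume "FinSeq xs \<le> s"
      then obtain ys where "x \<in> node (xs @ ys)"
        using dia_node node_reaches s x unfolding h_def by blast
      then show "\<exists>t\<in>h x. FinSeq xs \<le> t"
        by (intro bexI[of _ "FinSeq (xs @ ys)"]) (simp_all add: h_def pt_def)
    qed
  next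
    fix s assume "s \<in> L2_space closure_of h x"
    then have below: "dia A x \<in> node xs" if "FinSeq xs \<le> s" for xs
      using that sees_pt unfolding L2_closure_of h_def sees_def by blast
    show "s \<in> h (dia A x)"
    proof (cases s)
      case (FinSeq xs)
      then show ?thesis using below by (simp add: h_def pt_def)
    next
      case (InfSeq b)
      then have "dia A x \<in> node (map b [0..<n])" for n
        by (intro below) simp
      then show ?thesis
        using branch[of "dia A x" b] x dia_closed InfSeq by (simp add: h_def pt_def)
    qed
  qed
  (* Every nonzero element is possible at the root, so some walk realises it. *)
  have h_nonempty: "h z \<noteq> {}" if z: "z \<in> carrier A" "z \<noteq> bot_el A" for z
  proof -
    have "dia A z \<in> node []"
      using root z by (simp add: node_def)
    then obtain ys where "z \<in> node ys"
      using node_reaches z by fastforce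
    then have "FinSeq ys \<in> h z"
      by (simp add: h_def pt_def)
    then show ?thesis by blast
  qed
  have h_bool: "h (bot_el A) = {}" "h (top_el A) = UNIV"
    "\<And>x y. x \<in> carrier A \<Longrightarrow> y \<in> carrier A \<Longrightarrow> h (meet A x y) = h x \<inter> h y"
    "\<And>x y. x \<in> carrier A \<Longrightarrow> y \<in> carrier A \<Longrightarrow> h (join A x y) = h x \<union> h y"
    "\<And>x. x \<in> carrier A \<Longrightarrow> h (cmpl A x) = - h x"
    unfolding h_def by (auto simp: ultrafilter_simps[OF ultra_pt])
  have h_le: "alg_le A x y" if "h x \<subseteq> h y" "x \<in> carrier A" "y \<in> carrier A" for x y
  proof -
    have "h (meet A x (cmpl A y)) = {}"
      using that by (auto simp: h_bool cmpl_closed)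
    then have "meet A x (cmpl A y) = bot_el A"
      using h_nonempty[of "meet A x (cmpl A y)"] that(2,3) meet_closed cmpl_closed by blast
    then show ?thesis
      by (simp add: le_iff_meet_cmpl that(2,3))
  qed
  have "inj_on h (carrier A)"
    by (intro inj_onI alg_le_antisym h_le) simp_all
  then have "embedding h A (space_alg L2_space)"
    by (simp add: embedding_def space_alg_def topspace_L2_space h_bool h_dia Compl_eq_Diff_UNIV
        meet_closed join_closed cmpl_closed bot_closed top_closed dia_closed)
  then show ?thesis by blast
qed


section \<open>Closure algebras of topological spaces\<close>

lemma closure_algebra_space_alg:
  assumes "topspace X \<noteq> {}"
  shows "closure_algebra (space_alg X)"
proof
  show "bot_el (space_alg X) \<noteq> top_el (space_alg X)"
    using assms by (auto simp: space_alg_def simp del: null_topspace_iff_trivial)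
  show "dia (space_alg X) (join (space_alg X) S T) = join (space_alg X) (dia (space_alg X) S) (dia (space_alg X) T)"
    "dia (space_alg X) (bot_el (space_alg X)) = bot_el (space_alg X)"
    "dia (space_alg X) S \<in> carrier (space_alg X)" for S T
    by (simp_all add: space_alg_def closure_of_Un closure_of_subset_topspace)
  show "alg_le (space_alg X) S (dia (space_alg X) S)" if "S \<in> carrier (space_alg X)" for S
    using that closure_of_subset[of S X] by (simp add: alg_le_def space_alg_def inf_absorb1)
  show "alg_le (space_alg X) (dia (space_alg X) (dia (space_alg X) S)) (dia (space_alg X) S)" for S
    by (simp add: alg_le_def space_alg_def)
qed (auto simp: space_alg_def)

text \<open>The empty sequence lies in the closure of every nonempty set.\<close>

lemma well_connected_L2: "well_connected (space_alg L2_space)"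
proof -
  have "FinSeq [] \<in> L2_space closure_of S" if "S \<noteq> {}" for S
  proof -
    have "FinSeq [] \<le> t" for t by (cases t) simp_all
    then show ?thesis
      using that by (auto simp: L2_closure_of)
  qed
  then show ?thesis
    by (simp add: well_connected_def space_alg_def) blast
qed

text \<open>A general space is a subalgebra that inherits its operations as total functions; an arbitrary
  subalgebra may differ from it off its carrier, which the logic does not notice.\<close>

lemma general_space_logic_iff_subalgebra:
  "(\<exists>P. general_space X P \<and> L = general_space_logic X P) \<longleftrightarrow>
   (\<exists>B. subalgebra B (space_alg X) \<and> L = alg_logic B)"
proof
  assume "\<exists>B. subalgebra B (space_alg X) \<and> L = alg_logic B"
  then obtain B where B: "subalgebra B (space_alg X)" and L: "L = alg_logic B"
    by blast
  have "general_space X (carrier B)"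
    using B by (simp add: general_space_def subset_alg_def subalgebra_def)
  moreover have "embedding (\<lambda>x. x) B (subset_alg X (carrier B))"
    using B by (simp add: embedding_def subset_alg_def subalgebra_def)
  then have "alg_logic B = alg_logic (subset_alg X (carrier B))"
    by (rule alg_logic_isomorphic) (simp add: subset_alg_def)
  ultimately show "\<exists>P. general_space X P \<and> L = general_space_logic X P"
    using L by (auto simp: general_space_logic_def)
qed (auto simp: general_space_def general_space_logic_def)

lemma subalgebra_embedding_image:
  assumes emb: "embedding h B A"
  shows "subalgebra (A\<lparr>carrier := h ` carrier B\<rparr>) A"
    and "alg_logic (A\<lparr>carrier := h ` carrier B\<rparr>) = alg_logic B"
proof -
  note hs = embedding_simps[OF emb]
  show "subalgebra (A\<lparr>carrier := h ` carrier B\<rparr>) A"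
    by (auto simp: subalgebra_def hs intro: image_eqI[of _ h] simp flip: hs(3,5,7,9,11,13))
  have "embedding h B (A\<lparr>carrier := h ` carrier B\<rparr>)"
    using emb by (auto simp: embedding_def)
  then show "alg_logic (A\<lparr>carrier := h ` carrier B\<rparr>) = alg_logic B"
    using alg_logic_isomorphic by fastforce
qed


section \<open>Well-connected logics are the logics over the tree\<close>

theorem theorem6p6:
  fixes L :: "fm set"
  assumes "infinite (UNIV :: 'a set)"
    and "logic_above_S4 L"
  shows "(well_connected_logic TYPE('a) L \<longleftrightarrow>
            (\<exists>P. general_space L2_space P \<and> L = general_space_logic L2_space P))
       \<and> ((\<exists>P. general_space L2_space P \<and> L = general_space_logic L2_space P) \<longleftrightarrow>
            (\<exists>B. subalgebra B (space_alg L2_space) \<and> L = alg_logic B))"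
proof -
  have "\<exists>B. subalgebra B (space_alg L2_space) \<and> L = alg_logic B"
    if wc: "well_connected_logic TYPE('a) L"
  proof -
    obtain A :: "'a modal_alg" where A: "closure_algebra A" "well_connected A" "L = alg_logic A"
      using wc by (auto simp: well_connected_logic_def)
    obtain C where C: "subalgebra C A" "countable (carrier C)" "alg_logic C = alg_logic A"
      using modal_algebra.countable_subalgebra_same_logic[OF closure_algebra.axioms(1)[OF A(1)]]
      by blast
    have emb: "embedding (\<lambda>x. x) C A"
      using C(1) by (rule subalgebra_imp_embedding)
    obtain h where h: "embedding h C (space_alg L2_space)"
      using closure_algebra.countable_well_connected_embeds_L2[OF embedding_closure_algebra[OF emb A(1)]
          embedding_well_connected[OF emb A(2)] C(2)] by blast
    show ?thesis
      using subalgebra_embedding_image[OF h] A(3) C(3) by blast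
  qed
  moreover have "well_connected_logic TYPE('a) L"
    if B: "subalgebra B (space_alg L2_space)" and L: "L = alg_logic B" for B
  proof -
    have L2: "closure_algebra (space_alg L2_space)"
      by (simp add: closure_algebra_space_alg topspace_L2_space)
    have embB: "embedding (\<lambda>x. x) B (space_alg L2_space)"
      using B by (rule subalgebra_imp_embedding)
    have clB: "closure_algebra B" and wcB: "well_connected B"
      using embedding_closure_algebra[OF embB L2] embedding_well_connected[OF embB well_connected_L2] .
    obtain C where C: "subalgebra C B" "countable (carrier C)" "alg_logic C = alg_logic B"
      using modal_algebra.countable_subalgebra_same_logic[OF closure_algebra.axioms(1)[OF clB]]
      by blast
    have embC: "embedding (\<lambda>x. x) C B"
      using C(1) by (rule subalgebra_imp_embedding)
    have clC: "closure_algebra C" and wcC: "well_connected C"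
      using embedding_closure_algebra[OF embC clB] embedding_well_connected[OF embC wcB] .
    obtain f :: "nat \<Rightarrow> 'a" where "inj f"
      using infinite_countable_subset[OF assms(1)] by blast
    then have "inj_on (f \<circ> to_nat_on (carrier C)) (carrier C)"
      using C(2) by (intro comp_inj_on) (auto intro: inj_on_subset)
    then obtain D :: "'a modal_alg" and h where D: "embedding h D C" "h ` carrier D = carrier C"
      using embedding_copy[OF closure_algebra.axioms(1)[OF clC]] by blast
    have "L = alg_logic D"
      using alg_logic_isomorphic[OF D] C(3) L by simp
    then show ?thesis
      using embedding_closure_algebra[OF D(1) clC] embedding_well_connected[OF D(1) wcC]
      by (auto simp: well_connected_logic_def)
  qed
  ultimately show ?thesis
    unfolding general_space_logic_iff_subalgebra by blast
qed

end
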